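(* For any $A\subseteq G$ satisfying $\mathrm{card}(A)<\mathfrak{b}$ there exists a family $G_0\subseteq H^\uparrow$ of cardinality $\mathfrak{c}$ such that for any $f\in A$ and $f_1,f_2\in G_0$ with $f_1\neq f_2$, the ideals $\mathcal{Z}_f,\mathcal{Z}_{f_1},\mathcal{Z}_{f_2}$ are pairwise incomparable with respect to inclusion.
   Context: $\omega=\{0,1,2,\ldots\}$ and $n\in\omega$ is identified with $\{0,\ldots,n-1\}$. $G$ is the set of all functions $g\colon\omega\to(0,\infty)$ such that $g(n)\to\infty$ and $\frac{n}{g(n)}\not\to 0$. For $g\in G$, $\mathcal{Z}_g=\{B\subseteq\omega:\ \lim_{n\to\infty}\frac{\mathrm{card}(B\cap n)}{g(n)}=0\}$, which is an ideal on $\omega$. $H^\uparrow$ is the set of all nondecreasing $g\in G$ with values in $\omega$. $\mathfrak{b}$ is the bounding number: the least cardinality of a subset of $\omega^\omega$ which is unbounded with respect to $\leq^\star$, where $\alpha\leq^\star\beta$ means $\alpha(n)\leq\beta(n)$ for all but finitely many $n$. $\mathfrak{c}$ is the cardinality of the continuum. *)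

theory Defs
  imports Complex_Main
begin

unbundle cardinal_syntax

definition le_star :: "(nat \<Rightarrow> nat) \<Rightarrow> (nat \<Rightarrow> nat) \<Rightarrow> bool" (infix "\<le>\<^sup>*" 50) where
  "\<alpha> \<le>\<^sup>* \<beta> \<longleftrightarrow> (\<forall>\<^sub>F n in sequentially. \<alpha> n \<le> \<beta> n)"

definition star_unbounded :: "(nat \<Rightarrow> nat) set \<Rightarrow> bool" where
  "star_unbounded F \<longleftrightarrow> \<not> (\<exists>\<beta>. \<forall>\<alpha>\<in>F. \<alpha> \<le>\<^sup>* \<beta>)"

text \<open>Cardinals are represented by cardinal orders, which are determined only up to \<open>=o\<close>.
  A least element of a set of cardinal orders is accordingly a choice of a minimal representative;
  it exists by lemma \<open>bounding_number_least\<close> below.\<close>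

definition bounding_number :: "(nat \<Rightarrow> nat) rel" where
  "bounding_number = (SOME r. (\<exists>F. star_unbounded F \<and> r = |F| ) \<and>
    (\<forall>F. star_unbounded F \<longrightarrow> r \<le>o |F| ))"

lemma star_unbounded_UNIV: "star_unbounded UNIV"
proof -
  have "\<not> (\<lambda>n. Suc (\<beta> n)) \<le>\<^sup>* \<beta>" for \<beta>
    by (simp add: le_star_def)
  then show ?thesis
    unfolding star_unbounded_def by blast
qed

lemma bounding_number_least:
  "(\<exists>F. star_unbounded F \<and> bounding_number = |F| ) \<and>
   (\<forall>F. star_unbounded F \<longrightarrow> bounding_number \<le>o |F| )"
proof -
  let ?R = "{|F| | F. star_unbounded F}"
  have "?R \<noteq> {}"
    using star_unbounded_UNIV by blast
  moreover have "\<forall>r\<in>?R. Card_order r"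
  proof
    fix r assume "r \<in> ?R"
    then obtain F where "r = |F|" by blast
    then show "Card_order r" by (simp only: card_of_Card_order)
  qed
  ultimately have "\<exists>r\<in>?R. \<forall>r'\<in>?R. r \<le>o r'"
    by (rule exists_minim_Card_order)
  then obtain r where "r \<in> ?R" "\<forall>r'\<in>?R. r \<le>o r'" ..
  then have "(\<exists>F. star_unbounded F \<and> r = |F| ) \<and> (\<forall>F. star_unbounded F \<longrightarrow> r \<le>o |F| )"
    by blast
  then show ?thesis
    unfolding bounding_number_def by (rule someI)
qed

definition continuum :: "real rel" where
  "continuum = |UNIV :: real set|"

definition G :: "(nat \<Rightarrow> real) set" where
  "G = {g. (\<forall>n. 0 < g n) \<and> filterlim g at_top sequentially \<and>
           \<not> (\<lambda>n. real n / g n) \<longlonglongrightarrow> 0}"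

definition H_up :: "(nat \<Rightarrow> real) set" where
  "H_up = {g \<in> G. mono g \<and> range g \<subseteq> \<nat>}"

definition Z_ideal :: "(nat \<Rightarrow> real) \<Rightarrow> nat set set" where
  "Z_ideal g = {B. (\<lambda>n. real (card (B \<inter> {..<n})) / g n) \<longlonglongrightarrow> 0}"

definition incomparable :: "'a set \<Rightarrow> 'a set \<Rightarrow> bool" where
  "incomparable X Y \<longleftrightarrow> \<not> X \<subseteq> Y \<and> \<not> Y \<subseteq> X"

end

theory Submission
  imports Defs "HOL-Library.Countable" "HOL-Library.Infinite_Set"
begin

text \<open>A block \<open>[p, q)\<close> whose length is comparable to \<open>g q\<close> but negligible against \<open>f\<close> on
  \<open>[p, \<infinity>)\<close> is cheap for \<open>f\<close> and expensive for \<open>g\<close>; a sparse union of such blocks lies in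
  \<open>Z\<^sub>f\<close> but not in \<open>Z\<^sub>g\<close>. Since \<open>|A| < \<bb>\<close>, there is one fast sequence \<open>a\<close>
  such that for every \<open>f \<in> A\<close> and almost all \<open>k\<close>, \<open>f\<close> drops below a multiple of the identity
  somewhere in \<open>[a\<^sub>k, a\<^sub>k\<^sub>+\<^sub>1)\<close> and exceeds \<open>(k + 1)\<^sup>2 a\<^sub>k\<close> from \<open>a\<^sub>k\<^sub>+\<^sub>1\<close> on. For
  \<open>X \<subseteq> \<nat>\<close>, let \<open>g\<^sub>X\<close> jump to \<open>k a\<^sub>k\<^sub>+\<^sub>1\<close> at \<open>a\<^sub>k\<close> for each \<open>k \<in> X\<close> and stay constant otherwise:
  directly after a jump \<open>g\<^sub>X\<close> dwarfs \<open>f\<close> at its dip, from two steps later until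
  the next jump it is much smaller than \<open>f\<close>. Running
  through continuum many almost disjoint sets \<open>X\<close> of multiples of 3 gives the family.\<close>

section \<open>Sparse unions of blocks and non-inclusion of ideals\<close>

lemma strict_mono_interval:
  fixes p :: "nat \<Rightarrow> nat"
  assumes "strict_mono p" "p i \<le> n"
  obtains j where "i \<le> j" "p j \<le> n" "n < p (Suc j)"
proof -
  define j where "j = (LEAST j. n < p (Suc j))"
  have "n < p (Suc n)"
    using strict_mono_imp_increasing[OF assms(1), of "Suc n"] by linarith
  then have j: "n < p (Suc j)"
    unfolding j_def by (rule LeastI)
  have "i \<le> j"
  proof -
    have "p i < p (Suc j)" using assms(2) j by (rule le_less_trans)
    then show ?thesis using strict_mono_less[OF assms(1)] by (simp add: less_Suc_eq_le)
  qed
  moreover have "p j \<le> n"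
  proof (cases j)
    case 0
    then show ?thesis using \<open>i \<le> j\<close> assms(2) by simp
  next
    case (Suc l)
    then have "\<not> n < p (Suc l)"
      using not_less_Least[of l "\<lambda>j. n < p (Suc j)"] j_def by simp
    then show ?thesis using Suc by simp
  qed
  ultimately show ?thesis using that j by blast
qed

text \<open>Dependent choice on pairs of endpoints. The last two conclusions let each block start so
  late that everything below the end of the previous block is already negligible against
  \<open>f\<close>.\<close>

lemma sparse_blocks:
  fixes f g :: "nat \<Rightarrow> real"
  assumes "filterlim f at_top sequentially"
    and step: "\<And>K. \<exists>p\<ge>K. \<exists>q>p. \<delta> * g q \<le> real (q - p) \<and> (\<forall>n\<ge>p. real K * real (q - p) \<le> f n)"
  obtains p q :: "nat \<Rightarrow> nat"
  where "\<And>i. p i < q i" "\<And>i. \<delta> * g (q i) \<le> real (q i - p i)"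
    "\<And>i n. p i \<le> n \<Longrightarrow> real i * real (q i - p i) \<le> f n"
    "\<And>i. q i \<le> p (Suc i)" "\<And>i n. p (Suc i) \<le> n \<Longrightarrow> real (Suc i) * real (q i) \<le> f n"
proof -
  define P where "P i s \<longleftrightarrow> fst s < snd s \<and> \<delta> * g (snd s) \<le> real (snd s - fst s) \<and>
    (\<forall>n\<ge>fst s. real i * real (snd s - fst s) \<le> f n)" for i :: nat and s :: "nat \<times> nat"
  define Q where "Q i s t \<longleftrightarrow> snd s \<le> fst t \<and> (\<forall>n\<ge>fst t. real (Suc i) * real (snd s) \<le> f n)"
    for i :: nat and s t :: "nat \<times> nat"
  have "\<exists>s. \<forall>i. P i (s i) \<and> Q i (s i) (s (Suc i))"
  proof (rule dependent_nat_choice)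
    show "\<exists>x. P 0 x"
    proof -
      obtain p q where "p < q" "\<delta> * g q \<le> real (q - p)"
          "\<forall>n\<ge>p. real 0 * real (q - p) \<le> f n"
        using step[of 0] by blast
      then have "P 0 (p, q)" by (simp add: P_def)
      then show ?thesis by blast
    qed
  next
    fix x i assume "P i x"
    obtain N where N: "\<forall>n\<ge>N. real (Suc i) * real (snd x) \<le> f n"
      using assms(1) unfolding filterlim_at_top eventually_sequentially by blast
    \<comment> \<open>One \<open>K\<close> serves three purposes: cheapness with factor
      \<open>Suc i\<close>, a start after the previous block, and a start beyond
      \<open>N\<close>.\<close>
    define K where "K = Suc i + snd x + N"
    obtain p q where pq: "p \<ge> K" "q > p" "\<delta> * g q \<le> real (q - p)"
        "\<forall>n\<ge>p. real K * real (q - p) \<le> f n"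
      using step[of K] by blast
    have "real (Suc i) * real (q - p) \<le> f n" if "n \<ge> p" for n
    proof -
      have "real (Suc i) * real (q - p) \<le> real K * real (q - p)"
        by (rule mult_right_mono) (simp_all add: K_def)
      then show ?thesis using pq(4) that by fastforce
    qed
    then have "P (Suc i) (p, q)"
      using pq by (simp add: P_def)
    moreover have "Q i x (p, q)"
      using N pq(1) by (simp add: Q_def K_def)
    ultimately show "\<exists>y. P (Suc i) y \<and> Q i x y" by blast
  qed
  then obtain s where s: "\<And>i. P i (s i)" "\<And>i. Q i (s i) (s (Suc i))" by blast
  show ?thesis
    by (rule that[of "fst \<circ> s" "snd \<circ> s"]) (use s in \<open>auto simp: P_def Q_def\<close>)
qed

text \<open>The witness is the union of the blocks from \<open>sparse_blocks\<close>. Against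
  \<open>f\<close>, both the current block and all earlier ones together are negligible; against
  \<open>g\<close>, each block alone has density at least \<open>\<delta>\<close> at its right
  end.\<close>

lemma Z_ideal_not_subset:
  fixes f g :: "nat \<Rightarrow> real"
  assumes f_top: "filterlim f at_top sequentially"
    and g_pos: "\<And>n. 0 < g n"
    and "0 < \<delta>"
    and step: "\<And>K. \<exists>p\<ge>K. \<exists>q>p. \<delta> * g q \<le> real (q - p) \<and> (\<forall>n\<ge>p. real K * real (q - p) \<le> f n)"
  shows "\<not> Z_ideal f \<subseteq> Z_ideal g"
proof -
  obtain p q :: "nat \<Rightarrow> nat" where
    less: "\<And>i. p i < q i" and long: "\<And>i. \<delta> * g (q i) \<le> real (q i - p i)" and
    cheap: "\<And>i n. p i \<le> n \<Longrightarrow> real i * real (q i - p i) \<le> f n" and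
    q_le: "\<And>i. q i \<le> p (Suc i)" and
    past: "\<And>i n. p (Suc i) \<le> n \<Longrightarrow> real (Suc i) * real (q i) \<le> f n"
    using sparse_blocks[OF f_top step] by blast
  have p_mono: "strict_mono p"
    unfolding strict_mono_Suc_iff using less_le_trans[OF less q_le] by blast
  have q_mono: "mono q"
    unfolding mono_iff_le_Suc using le_trans[OF q_le less_imp_le[OF less]] by blast
  define B where "B = (\<Union>i. {p i..<q i})"
  have f_bound: "real (Suc i) * real (card (B \<inter> {..<n})) \<le> 2 * f n" if "p (Suc i) \<le> n" for i n
  proof -
    obtain j where j: "Suc i \<le> j" "p j \<le> n" "n < p (Suc j)"
      using strict_mono_interval[OF p_mono \<open>p (Suc i) \<le> n\<close>] .
    then obtain l where l: "j = Suc l" "i \<le> l" by (cases j) auto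
    \<comment> \<open>Later blocks start beyond \<open>n\<close>, and earlier ones end by
      \<open>q l\<close>. Multiplied by \<open>j\<close>, each of the two parts is at most
      \<open>f n\<close>, by \<open>past\<close> and \<open>cheap\<close>; hence the factor
      2.\<close>
    have "B \<inter> {..<n} \<subseteq> {..<q l} \<union> {p j..<q j}"
    proof
      fix x assume "x \<in> B \<inter> {..<n}"
      then obtain m where m: "p m \<le> x" "x < q m" "x < n" unfolding B_def by auto
      then have "m < Suc j"
        using j(3) strict_mono_less[OF p_mono, of m "Suc j"] by linarith
      then have "m \<le> l \<or> m = j" using l by linarith
      then show "x \<in> {..<q l} \<union> {p j..<q j}"
        using m monoD[OF q_mono, of m l] by auto
    qed
    then have "card (B \<inter> {..<n}) \<le> card ({..<q l} \<union> {p j..<q j})"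
      by (intro card_mono) auto
    also have "\<dots> \<le> q l + (q j - p j)"
      using card_Un_le[of "{..<q l}" "{p j..<q j}"] by simp
    finally have "real (card (B \<inter> {..<n})) \<le> real (q l) + real (q j - p j)" by linarith
    then have "real (Suc i) * real (card (B \<inter> {..<n})) \<le> real j * (real (q l) + real (q j - p j))"
      using j(1) by (intro mult_mono) auto
    also have "\<dots> \<le> 2 * f n"
      using cheap[of j n] past[of l n] j(2) l by (simp add: distrib_left)
    finally show ?thesis .
  qed
  have "(\<lambda>n. real (card (B \<inter> {..<n})) / f n) \<longlonglongrightarrow> 0"
  proof (rule LIMSEQ_I)
    fix r :: real assume "0 < r"
    obtain i :: nat where i: "2 / r < real i" using reals_Archimedean2 by blast
    obtain N where N: "\<forall>n\<ge>N. 1 \<le> f n"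
      using f_top unfolding filterlim_at_top eventually_sequentially by blast
    have "norm (real (card (B \<inter> {..<n})) / f n - 0) < r" if "n \<ge> max N (p (Suc i))" for n
    proof -
      have f: "1 \<le> f n" using N that by auto
      have "2 < real (Suc i) * r" using i \<open>0 < r\<close> by (simp add: field_simps)
      then have "real (Suc i) * real (card (B \<inter> {..<n})) < real (Suc i) * r * f n"
      proof -
        have "2 * f n < real (Suc i) * r * f n"
          using \<open>2 < real (Suc i) * r\<close> f by (intro mult_strict_right_mono) auto
        moreover have "p (Suc i) \<le> n" using that by simp
        ultimately show ?thesis using f_bound by (meson le_less_trans)
      qed
      then have "real (card (B \<inter> {..<n})) < r * f n"
        by (simp only: mult.assoc mult_less_cancel_left_pos of_nat_0_less_iff zero_less_Suc)
      then show ?thesis using f by (simp add: field_simps)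
    qed
    then show "\<exists>no. \<forall>n\<ge>no. norm (real (card (B \<inter> {..<n})) / f n - 0) < r" by blast
  qed
  then have "B \<in> Z_ideal f" by (simp add: Z_ideal_def)
  moreover have "B \<notin> Z_ideal g"
  proof
    assume "B \<in> Z_ideal g"
    then have "(\<lambda>n. real (card (B \<inter> {..<n})) / g n) \<longlonglongrightarrow> 0" by (simp add: Z_ideal_def)
    then obtain N where N: "\<forall>n\<ge>N. norm (real (card (B \<inter> {..<n})) / g n - 0) < \<delta>"
      using LIMSEQ_D \<open>0 < \<delta>\<close> by blast
    \<comment> \<open>Evaluating at the right end of block \<open>N\<close> is within the range of
      the limit estimate, and this block alone contradicts it.\<close>
    have "N \<le> q N"
      using strict_mono_imp_increasing[OF p_mono, of N] less[of N] by linarith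
    then have "real (card (B \<inter> {..<q N})) < \<delta> * g (q N)"
      using N g_pos[of "q N"] by (auto simp: field_simps)
    moreover have "card {p N..<q N} \<le> card (B \<inter> {..<q N})"
      by (rule card_mono) (auto simp: B_def)
    ultimately show False using long[of N] by simp
  qed
  ultimately show ?thesis by blast
qed

section \<open>Growth moduli of functions in \<open>G\<close> and their domination\<close>

lemma G_growth:
  assumes "f \<in> G"
  obtains c :: nat and \<alpha> :: "nat \<Rightarrow> nat" where
    "\<And>m. \<exists>q\<ge>m. q < \<alpha> m \<and> f q \<le> real c * real q"
    "\<And>m n. \<alpha> m \<le> n \<Longrightarrow> real m \<le> f n"
proof -
  have f: "\<And>n. 0 < f n" "filterlim f at_top sequentially" "\<not> (\<lambda>n. real n / f n) \<longlonglongrightarrow> 0"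
    using assms by (auto simp: G_def)
  \<comment> \<open>Failure of convergence to 0 gives a fixed \<open>r\<close> with
    \<open>f n \<le> n / r\<close> for arbitrarily large \<open>n\<close>; \<open>c\<close> rounds
    \<open>1 / r\<close> up.\<close>
  obtain r where r: "0 < r" "\<And>m. \<exists>n\<ge>m. r \<le> norm (real n / f n)"
    using f(3) unfolding LIMSEQ_iff by (auto simp: not_less)
  obtain c :: nat where c: "1 / r < real c" using reals_Archimedean2 by blast
  have good: "\<exists>q\<ge>m. f q \<le> real c * real q" for m
  proof -
    obtain n where n: "n \<ge> m" "r \<le> norm (real n / f n)" using r(2) by blast
    then have "r * f n \<le> real n" using f(1)[of n] by (simp add: field_simps)
    then have "f n \<le> 1 / r * real n" using r(1) by (simp add: field_simps)
    also have "\<dots> \<le> real c * real n" using c by (intro mult_right_mono) auto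
    finally have "f n \<le> real c * real n" .
    then show ?thesis using n by blast
  qed
  \<comment> \<open>A single modulus records both a dip of \<open>f\<close> after \<open>m\<close>
    and a point from which \<open>f\<close> stays at least \<open>m\<close>, so only one function
    per \<open>f\<close> has to be dominated.\<close>
  have "\<exists>N. (\<exists>q\<ge>m. q < N \<and> f q \<le> real c * real q) \<and> (\<forall>n\<ge>N. real m \<le> f n)" for m
  proof -
    obtain q where q: "q \<ge> m" "f q \<le> real c * real q" using good by blast
    obtain N where N: "\<forall>n\<ge>N. real m \<le> f n"
      using f(2) unfolding filterlim_at_top eventually_sequentially by blast
    show ?thesis
      by (rule exI[of _ "max (Suc q) N"]) (use q N in auto)
  qed
  then obtain \<alpha> where "\<forall>m. (\<exists>q\<ge>m. q < \<alpha> m \<and> f q \<le> real c * real q) \<and> (\<forall>n\<ge>\<alpha> m. real m \<le> f n)"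
    by metis
  then show ?thesis using that by blast
qed

text \<open>The image of \<open>A\<close> under \<open>\<alpha>\<close> has at most
  \<open>|A|\<close> elements, too few to be unbounded.\<close>

lemma bounded_if_less_bounding_number:
  assumes "|A| <o bounding_number"
  obtains \<beta> where "\<And>x. x \<in> A \<Longrightarrow> \<alpha> x \<le>\<^sup>* \<beta>"
proof -
  have "\<not> star_unbounded (\<alpha> ` A)"
  proof
    assume "star_unbounded (\<alpha> ` A)"
    then have "bounding_number \<le>o |\<alpha> ` A|" using bounding_number_least by blast
    also have "|\<alpha> ` A| \<le>o |A|" by (rule card_of_image)
    finally show False using assms not_ordLess_ordLeq by blast
  qed
  then show ?thesis using that unfolding star_unbounded_def by blast
qed

section \<open>Index sets for continuum many functions\<close>

lemma infinite_multiples_diff: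
  obtains X :: "real \<Rightarrow> nat set"
  where "\<And>x k. k \<in> X x \<Longrightarrow> 3 dvd k" "\<And>x y. x \<noteq> y \<Longrightarrow> infinite (X x - X y)"
proof -
  \<comment> \<open>A real \<open>x\<close> is coded by the graph of
    \<open>n \<mapsto> \<lfloor>n * x\<rfloor>\<close>. Since \<open>n\<close> is part of the code,
    two codes can agree only at the same \<open>n\<close>, and for
    \<open>n > 1 / \<bar>x - y\<bar>\<close> the floors differ. The factor 3 spaces the indices,
    leaving a flat stretch after each jump.\<close>
  define h :: "real \<Rightarrow> nat \<Rightarrow> nat" where "h x n = 3 * to_nat (n, \<lfloor>real n * x\<rfloor>)" for x n
  have h_eq: "h x n = h y m \<longleftrightarrow> n = m \<and> \<lfloor>real n * x\<rfloor> = \<lfloor>real m * y\<rfloor>" for x y n m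
    by (simp add: h_def)
  have "infinite (range (h x) - range (h y))" if "x \<noteq> y" for x y
  proof -
    obtain N :: nat where N: "1 / \<bar>x - y\<bar> < real N" using reals_Archimedean2 by blast
    have "h x n \<notin> range (h y)" if "n \<ge> N" for n
    proof
      assume "h x n \<in> range (h y)"
      then have "\<lfloor>real n * x\<rfloor> = \<lfloor>real n * y\<rfloor>" by (auto simp: h_eq)
      then have "\<bar>real n * x - real n * y\<bar> < 1" by linarith
      then have "real n * \<bar>x - y\<bar> < 1" by (simp add: abs_mult flip: right_diff_distrib)
      moreover have "1 < real N * \<bar>x - y\<bar>" using N \<open>x \<noteq> y\<close> by (simp add: field_simps)
      moreover have "real N * \<bar>x - y\<bar> \<le> real n * \<bar>x - y\<bar>"
        using \<open>n \<ge> N\<close> by (intro mult_right_mono) auto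
      ultimately show False by linarith
    qed
    then have "h x ` {N..} \<subseteq> range (h x) - range (h y)" by auto
    moreover have "infinite (h x ` {N..})"
      by (subst finite_image_iff) (auto simp: inj_on_def h_eq infinite_Ici)
    ultimately show ?thesis using finite_subset by blast
  qed
  then show ?thesis
    by (intro that[of "\<lambda>x. range (h x)"]) (auto simp: h_def)
qed

section \<open>Jump functions along a fast sequence\<close>

definition jump :: "(nat \<Rightarrow> nat) \<Rightarrow> nat set \<Rightarrow> nat \<Rightarrow> nat" where
  "jump a X n = Max (insert 1 ((\<lambda>k. k * a (Suc k)) ` {k \<in> X. a k \<le> n}))"

text \<open>\<open>grow\<close> leaves room in \<open>[a k, a (Suc k))\<close> for a block that
  starts at \<open>a k\<close> and has length up to \<open>(Suc k)\<^sup>2 * a k\<close>.\<close>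

locale fast_sequence =
  fixes a :: "nat \<Rightarrow> nat"
  assumes pos: "0 < a 0"
    and grow: "a k + (Suc k)\<^sup>2 * a k < a (Suc k)"
begin

lemma strict_mono_a: "strict_mono a"
  unfolding strict_mono_Suc_iff using le_less_trans[OF le_add1 grow] by blast

lemma Suc_le_a: "Suc k \<le> a k"
proof (induction k)
  case 0
  then show ?case using pos by simp
next
  case (Suc k)
  then show ?case using strict_monoD[OF strict_mono_a, of k "Suc k"] by simp
qed

lemma finite_index: "finite {k \<in> X. a k \<le> n}"
proof (rule finite_subset)
  show "{k \<in> X. a k \<le> n} \<subseteq> {..n}"
    using le_trans[OF Suc_leD[OF Suc_le_a]] by auto
qed simp

lemma jump_pos: "0 < jump a X n"
proof -
  \<comment> \<open>The inserted 1 is the value before any jump; it also covers the index 0, whose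
    jump has height 0.\<close>
  have "1 \<le> jump a X n"
    unfolding jump_def using finite_index by (intro Max_ge) auto
  then show ?thesis by simp
qed

lemma mono_jump: "mono (jump a X)"
proof (rule monoI)
  fix m n :: nat assume "m \<le> n"
  then show "jump a X m \<le> jump a X n"
    unfolding jump_def using finite_index by (intro Max_mono) auto
qed

lemma jump_ge: "k \<in> X \<Longrightarrow> a k \<le> n \<Longrightarrow> k * a (Suc k) \<le> jump a X n"
  unfolding jump_def using finite_index by (intro Max_ge) auto

text \<open>At \<open>n\<close> only jumps with index below \<open>i\<close> have happened, and
  their heights increase with the index. \<open>0 < k\<close> lets the bound absorb the default
  value 1.\<close>

lemma jump_le:
  assumes "n < a i" "\<And>j. j \<in> X \<Longrightarrow> j < i \<Longrightarrow> j \<le> k" "0 < k"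
  shows "jump a X n \<le> k * a (Suc k)"
proof -
  have "1 \<le> k * a (Suc k)"
    using \<open>0 < k\<close> Suc_le_a[of "Suc k"] by (simp add: Suc_le_eq)
  moreover have "j * a (Suc j) \<le> k * a (Suc k)" if "j \<in> X" "a j \<le> n" for j
  proof -
    have "j < i" using that assms(1) strict_mono_less[OF strict_mono_a, of j i] by linarith
    then have "j \<le> k" using assms(2) that by blast
    then show ?thesis
      using strict_mono_a by (intro mult_le_mono) (auto simp: strict_mono_less_eq)
  qed
  ultimately show ?thesis
    unfolding jump_def using finite_index by (subst Max_le_iff) auto
qed

text \<open>The next multiple of 3 after \<open>k\<close> is \<open>k + 3\<close>, so no jump occurs
  in between.\<close>

lemma jump_small:
  assumes "\<And>j. j \<in> X \<Longrightarrow> 3 dvd j" "k \<in> X" "0 < k" "n < a (k + 3)"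
  shows "jump a X n \<le> k * a (Suc k)"
proof (rule jump_le[OF assms(4)])
  fix j assume "j \<in> X" "j < k + 3"
  then show "j \<le> k" using assms(1)[of j] assms(1)[OF assms(2)] by presburger
qed fact

text \<open>Provides a block inside the flat stretch after jump \<open>k\<close> that is as long as
  the height of that jump.\<close>

lemma flat_block: "a (k + 2) + k * a (Suc k) < a (k + 3)"
proof -
  have "k * a (Suc k) \<le> (Suc (k + 2))\<^sup>2 * a (k + 2)"
    using strict_mono_a
    by (intro mult_le_mono) (auto simp: strict_mono_less_eq power2_eq_square)
  then show ?thesis using grow[of "k + 2"] by (simp add: numeral_eq_Suc)
qed

lemma jump_in_H_up:
  assumes "\<And>j. j \<in> X \<Longrightarrow> 3 dvd j" "infinite X"
  shows "(\<lambda>n. real (jump a X n)) \<in> H_up"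
proof -
  have large: "\<exists>k\<in>X. m < k" for m
    using assms(2) by (simp add: infinite_nat_iff_unbounded) blast
  have "filterlim (jump a X) at_top sequentially"
    unfolding filterlim_at_top eventually_sequentially
  proof
    fix Z
    obtain k where k: "k \<in> X" "Z < k" using large by blast
    have "Z \<le> jump a X n" if "a k \<le> n" for n
    proof -
      have "k * 1 \<le> k * a (Suc k)"
        using Suc_le_a[of "Suc k"] by (intro mult_le_mono2) simp
      then show ?thesis using jump_ge[OF k(1) that] k(2) by linarith
    qed
    then show "\<exists>N. \<forall>n\<ge>N. Z \<le> jump a X n" by blast
  qed
  then have "filterlim (\<lambda>n. real (jump a X n)) at_top sequentially"
    by (rule filterlim_compose[OF filterlim_real_sequentially])
  moreover have "\<not> (\<lambda>n. real n / real (jump a X n)) \<longlonglongrightarrow> 0"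
  proof
    assume "(\<lambda>n. real n / real (jump a X n)) \<longlonglongrightarrow> 0"
    then obtain N where N: "\<forall>n\<ge>N. norm (real n / real (jump a X n) - 0) < 1"
      using LIMSEQ_D zero_less_one by blast
    obtain k where k: "k \<in> X" "N < k" using large by blast
    \<comment> \<open>At the end of the flat block the argument has caught up with the value, so the
      quotient is at least 1 there.\<close>
    define n where "n = a (k + 2) + k * a (Suc k)"
    have "jump a X n \<le> k * a (Suc k)"
      using flat_block k by (intro jump_small assms(1)) (auto simp: n_def)
    then have "jump a X n \<le> n" by (simp add: n_def)
    moreover have "N \<le> n" using Suc_le_a[of "k + 2"] k(2) by (simp add: n_def)
    ultimately show False using N jump_pos[of X n] by (auto simp: field_simps)
  qed
  moreover have "mono (\<lambda>n. real (jump a X n))"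
    using mono_jump by (auto simp: mono_def)
  ultimately show ?thesis
    using jump_pos by (auto simp: H_up_def G_def)
qed

text \<open>For \<open>k\<close> in \<open>X - Y\<close>, a block starting at \<open>a k\<close>
  lies after a jump for \<open>X\<close>, hence is cheap, while the function for \<open>Y\<close> is
  still low.\<close>

lemma Z_ideal_jump_not_subset:
  assumes "infinite (X - Y)" "\<And>j. j \<in> X \<Longrightarrow> 3 dvd j"
  shows "\<not> Z_ideal (\<lambda>n. real (jump a X n)) \<subseteq> Z_ideal (\<lambda>n. real (jump a Y n))"
proof (rule Z_ideal_not_subset[where \<delta> = 1])
  have "infinite X" using assms(1) by (meson finite_Diff)
  then show "filterlim (\<lambda>n. real (jump a X n)) at_top sequentially"
    using jump_in_H_up[OF assms(2)] by (simp add: H_up_def G_def)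
next
  fix K :: nat
  obtain k where k: "k \<in> X" "k \<notin> Y" "Suc K < k"
    using assms(1) by (simp add: infinite_nat_iff_unbounded) blast
  define q where "q = a k + k * a k"
  have q: "q < a (Suc k)"
  proof -
    have "k * a k \<le> (Suc k)\<^sup>2 * a k"
      by (intro mult_le_mono) (auto simp: power2_eq_square)
    then show ?thesis unfolding q_def using grow[of k] by linarith
  qed
  \<comment> \<open>As \<open>k\<close> is missing from \<open>Y\<close>, the last jump has index at
    most \<open>k - 1\<close> and height at most \<open>(k - 1) * a k\<close>, less than the block
    length \<open>k * a k\<close>.\<close>
  have "jump a Y q \<le> (k - 1) * a (Suc (k - 1))"
  proof (rule jump_le[OF q])
    fix j assume "j \<in> Y" "j < Suc k"
    then show "j \<le> k - 1" using k(2) by (cases "j = k") auto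
  qed (use k(3) in simp)
  also have "\<dots> \<le> k * a k" using k(3) by simp
  finally have "jump a Y q \<le> q - a k" by (simp add: q_def)
  then have "1 * real (jump a Y q) \<le> real (q - a k)" by simp
  moreover have "real K * real (q - a k) \<le> real (jump a X n)" if "a k \<le> n" for n
  proof -
    have "K * (q - a k) \<le> k * a (Suc k)"
      using k(3) q by (intro mult_le_mono) auto
    also have "\<dots> \<le> jump a X n" using jump_ge k(1) that by blast
    finally show ?thesis by (simp flip: of_nat_mult)
  qed
  moreover have "a k < q" using k(3) Suc_le_a[of k] by (simp add: q_def)
  moreover have "K \<le> a k" using Suc_le_a[of k] k(3) by linarith
  ultimately show "\<exists>p\<ge>K. \<exists>q>p. 1 * real (jump a Y q) \<le> real (q - p) \<and>
      (\<forall>n\<ge>p. real K * real (q - p) \<le> real (jump a X n))" by blast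
qed (simp_all add: jump_pos)

text \<open>In one direction the blocks lie in the flat stretches, where \<open>f\<close> is large
  by \<open>large\<close>; in the other they run from a jump to a dip of \<open>f\<close>, where
  \<open>dips\<close> keeps \<open>f\<close> linear.\<close>

lemma incomparable_jump:
  assumes X: "\<And>j. j \<in> X \<Longrightarrow> 3 dvd j" "infinite X"
    and "f \<in> G"
    and dips: "\<forall>\<^sub>F k in sequentially. \<exists>q\<ge>2 * a k. q < a (Suc k) \<and> f q \<le> real c * real q"
    and large: "\<forall>\<^sub>F k in sequentially. \<forall>n\<ge>a (Suc k). real ((Suc k)\<^sup>2 * a k) \<le> f n"
  shows "incomparable (Z_ideal f) (Z_ideal (\<lambda>n. real (jump a X n)))"
proof -
  have f: "\<And>n. 0 < f n" "filterlim f at_top sequentially"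
    using \<open>f \<in> G\<close> by (auto simp: G_def)
  have g: "filterlim (\<lambda>n. real (jump a X n)) at_top sequentially"
    using jump_in_H_up[OF X] by (simp add: H_up_def G_def)
  obtain N\<^sub>1 where N\<^sub>1: "\<And>k. k \<ge> N\<^sub>1 \<Longrightarrow> \<exists>q\<ge>2 * a k. q < a (Suc k) \<and> f q \<le> real c * real q"
    using dips unfolding eventually_sequentially by blast
  obtain N\<^sub>2 where N\<^sub>2: "\<And>k n. k \<ge> N\<^sub>2 \<Longrightarrow> a (Suc k) \<le> n \<Longrightarrow> real ((Suc k)\<^sup>2 * a k) \<le> f n"
    using large unfolding eventually_sequentially by blast
  have X_large: "\<exists>k\<in>X. m < k" for m
    using X(2) by (simp add: infinite_nat_iff_unbounded) blast
  have "\<not> Z_ideal f \<subseteq> Z_ideal (\<lambda>n. real (jump a X n))"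
  proof (rule Z_ideal_not_subset[where \<delta> = 1])
    fix K :: nat
    obtain k where k: "k \<in> X" "K + N\<^sub>2 < k" using X_large by blast
    \<comment> \<open>Starting two steps after the jump makes \<open>large\<close> at index
      \<open>Suc k\<close> available: \<open>f\<close> is then at least
      \<open>(k + 2)\<^sup>2 * a (Suc k)\<close>, against a block length of
      \<open>k * a (Suc k)\<close>.\<close>
    define p where "p = a (k + 2)"
    define q where "q = p + k * a (Suc k)"
    have "jump a X q \<le> k * a (Suc k)"
      using flat_block k by (intro jump_small X(1)) (auto simp: p_def q_def)
    then have "jump a X q \<le> q - p" by (simp add: q_def)
    then have "1 * real (jump a X q) \<le> real (q - p)" by simp
    moreover have "real K * real (q - p) \<le> f n" if "p \<le> n" for n
    proof -
      have "K * k \<le> (Suc (Suc k))\<^sup>2"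
        unfolding power2_eq_square using k(2) by (intro mult_le_mono) auto
      then have "K * (q - p) \<le> (Suc (Suc k))\<^sup>2 * a (Suc k)"
        by (simp add: q_def mult_le_mono1 flip: mult.assoc)
      then have "real K * real (q - p) \<le> real ((Suc (Suc k))\<^sup>2 * a (Suc k))"
        by (simp only: of_nat_mult[symmetric] of_nat_le_iff)
      also have "\<dots> \<le> f n"
        using N\<^sub>2[of "Suc k" n] k(2) that by (simp add: p_def)
      finally show ?thesis .
    qed
    moreover have "p < q" using k(2) Suc_le_a[of "Suc k"] by (simp add: q_def)
    moreover have "K \<le> p" using Suc_le_a[of "k + 2"] k(2) by (simp add: p_def)
    ultimately show "\<exists>p\<ge>K. \<exists>q>p. 1 * real (jump a X q) \<le> real (q - p) \<and>
        (\<forall>n\<ge>p. real K * real (q - p) \<le> f n)" by blast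
  qed (use f jump_pos in auto)
  moreover have "\<not> Z_ideal (\<lambda>n. real (jump a X n)) \<subseteq> Z_ideal f"
  \<comment> \<open>The 2 comes from \<open>q \<ge> 2 * a k\<close>, by which the block
    \<open>[a k, q)\<close> is at least half of \<open>q\<close>; \<open>c + 1\<close> in place of
    \<open>c\<close> keeps the denominator positive.\<close>
  proof (rule Z_ideal_not_subset[where \<delta> = "1 / (2 * (real c + 1))", OF g])
    fix K :: nat
    obtain k where k: "k \<in> X" "K + N\<^sub>1 < k" using X_large by blast
    obtain q where q: "2 * a k \<le> q" "q < a (Suc k)" "f q \<le> real c * real q"
      using N\<^sub>1[of k] k(2) by auto
    have "f q \<le> (real c + 1) * real q" using q(3) by (simp add: distrib_right)
    moreover have "real q \<le> 2 * real (q - a k)" using q(1) by linarith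
    ultimately have "f q \<le> (real c + 1) * (2 * real (q - a k))"
      by (smt (verit) mult_left_mono of_nat_0_le_iff)
    then have "1 / (2 * (real c + 1)) * f q \<le> real (q - a k)"
      by (simp add: field_simps)
    moreover have "real K * real (q - a k) \<le> real (jump a X n)" if "a k \<le> n" for n
    proof -
      have "K * (q - a k) \<le> k * a (Suc k)"
        using k(2) q(2) by (intro mult_le_mono) auto
      also have "\<dots> \<le> jump a X n" using jump_ge k(1) that by blast
      finally show ?thesis by (simp flip: of_nat_mult)
    qed
    moreover have "a k < q" using q(1) Suc_le_a[of k] by linarith
    moreover have "K \<le> a k" using Suc_le_a[of k] k(2) by linarith
    ultimately show "\<exists>p\<ge>K. \<exists>q>p. 1 / (2 * (real c + 1)) * f q \<le> real (q - p) \<and>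
        (\<forall>n\<ge>p. real K * real (q - p) \<le> real (jump a X n))" by blast
  qed (use f in auto)
  ultimately show ?thesis by (simp add: incomparable_def)
qed

end

section \<open>The fast sequence from a dominating function, and the family\<close>

primrec fast :: "(nat \<Rightarrow> nat) \<Rightarrow> nat \<Rightarrow> nat" where
  "fast \<beta> 0 = 1"
| "fast \<beta> (Suc k) =
    Suc (fast \<beta> k + (Suc k)\<^sup>2 * fast \<beta> k + \<beta> (2 * (Suc k)\<^sup>2 * fast \<beta> k))"

interpretation fast: fast_sequence "fast \<beta>" for \<beta>
  by unfold_locales simp_all

text \<open>The argument is at least \<open>k\<close>, so \<open>\<alpha>\<close> is eventually
  below \<open>\<beta>\<close> there, and the recursion for \<open>fast\<close> adds exactly this
  value of \<open>\<beta>\<close>.\<close>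

lemma fast_eventually:
  assumes "\<alpha> \<le>\<^sup>* \<beta>"
  shows "\<forall>\<^sub>F k in sequentially. \<alpha> (2 * (Suc k)\<^sup>2 * fast \<beta> k) \<le> fast \<beta> (Suc k)"
proof -
  obtain N where N: "\<And>n. n \<ge> N \<Longrightarrow> \<alpha> n \<le> \<beta> n"
    using assms unfolding le_star_def eventually_sequentially by blast
  have "\<alpha> (2 * (Suc k)\<^sup>2 * fast \<beta> k) \<le> fast \<beta> (Suc k)" if "k \<ge> N" for k
  proof -
    have "1 * k \<le> 2 * (Suc k)\<^sup>2 * fast \<beta> k"
      using fast.Suc_le_a[of k \<beta>] by (intro mult_le_mono) auto
    then show ?thesis using N[of "2 * (Suc k)\<^sup>2 * fast \<beta> k"] that by simp
  qed
  then show ?thesis unfolding eventually_sequentially by blast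
qed

theorem theorem2:
  fixes A :: "(nat \<Rightarrow> real) set"
  assumes "A \<subseteq> G" and "|A| <o bounding_number"
  shows "\<exists>G\<^sub>0. G\<^sub>0 \<subseteq> H_up \<and> |G\<^sub>0| =o continuum \<and>
    (\<forall>f\<in>A. \<forall>f\<^sub>1\<in>G\<^sub>0. \<forall>f\<^sub>2\<in>G\<^sub>0. f\<^sub>1 \<noteq> f\<^sub>2 \<longrightarrow>
      incomparable (Z_ideal f) (Z_ideal f\<^sub>1) \<and>
      incomparable (Z_ideal f) (Z_ideal f\<^sub>2) \<and>
      incomparable (Z_ideal f\<^sub>1) (Z_ideal f\<^sub>2))"
proof -
  have "\<forall>f\<in>A. \<exists>c \<alpha>. (\<forall>m. \<exists>q\<ge>m. q < \<alpha> m \<and> f q \<le> real (c::nat) * real q) \<and>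
      (\<forall>m n. \<alpha> m \<le> n \<longrightarrow> real m \<le> f n)"
    using assms(1) by (metis G_growth subsetD)
  then obtain c :: "_ \<Rightarrow> nat" and \<alpha> where
    dips: "\<And>f m. f \<in> A \<Longrightarrow> \<exists>q\<ge>m. q < \<alpha> f m \<and> f q \<le> real (c f) * real q" and
    large: "\<And>f m n. f \<in> A \<Longrightarrow> \<alpha> f m \<le> n \<Longrightarrow> real m \<le> f n"
    by metis
  obtain \<beta> where \<beta>: "\<And>f. f \<in> A \<Longrightarrow> \<alpha> f \<le>\<^sup>* \<beta>"
    using bounded_if_less_bounding_number[OF assms(2)] by blast
  obtain X :: "real \<Rightarrow> nat set" where
    X: "\<And>x k. k \<in> X x \<Longrightarrow> 3 dvd k" "\<And>x y. x \<noteq> y \<Longrightarrow> infinite (X x - X y)"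
    using infinite_multiples_diff by blast
  have X_inf: "infinite (X x)" for x
    using X(2)[of x "x + 1"] by (auto dest: finite_Diff)
  define g where "g x n = real (jump (fast \<beta>) (X x) n)" for x n
  have g_diff: "\<not> Z_ideal (g x) \<subseteq> Z_ideal (g y)" if "x \<noteq> y" for x y
    unfolding g_def using fast.Z_ideal_jump_not_subset X that by blast
  \<comment> \<open>Equal functions have equal ideals, so non-inclusion already forces injectivity
    and the range is as large as the reals.\<close>
  have "inj g"
    using g_diff by (metis injI order_refl)
  have "|range g| =o continuum"
    unfolding continuum_def using \<open>inj g\<close> by (metis card_of_ordIsoI inj_on_imp_bij_betw ordIso_symmetric)
  moreover have "range g \<subseteq> H_up"
    using fast.jump_in_H_up[OF X(1) X_inf] by (auto simp: g_def[abs_def])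
  moreover have "incomparable (Z_ideal f) (Z_ideal (g x))" if f_in: "f \<in> A" for f x
  proof -
    \<comment> \<open>The argument of \<open>\<alpha> f\<close> serves twice: it exceeds
      \<open>2 * fast \<beta> k\<close>, which places the dip, and
      \<open>(Suc k)\<^sup>2 * fast \<beta> k\<close>, which bounds \<open>f\<close> from
      below.\<close>
    have ev: "\<forall>\<^sub>F k in sequentially. \<alpha> f (2 * (Suc k)\<^sup>2 * fast \<beta> k) \<le> fast \<beta> (Suc k)"
      using fast_eventually \<beta> f_in by blast
    have "\<forall>\<^sub>F k in sequentially. \<exists>q\<ge>2 * fast \<beta> k. q < fast \<beta> (Suc k) \<and> f q \<le> real (c f) * real q"
      using ev
    proof eventually_elim
      case (elim k)
      obtain q where q: "2 * (Suc k)\<^sup>2 * fast \<beta> k \<le> q" "q < \<alpha> f (2 * (Suc k)\<^sup>2 * fast \<beta> k)"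
          "f q \<le> real (c f) * real q"
        using dips[OF f_in, of "2 * (Suc k)\<^sup>2 * fast \<beta> k"] by blast
      have "2 * 1 * fast \<beta> k \<le> 2 * (Suc k)\<^sup>2 * fast \<beta> k"
        by (intro mult_le_mono) auto
      then have "2 * fast \<beta> k \<le> q" using q(1) by linarith
      then show ?case using q elim by (meson less_le_trans)
    qed
    moreover have "\<forall>\<^sub>F k in sequentially. \<forall>n\<ge>fast \<beta> (Suc k). real ((Suc k)\<^sup>2 * fast \<beta> k) \<le> f n"
      using ev
    proof eventually_elim
      case (elim k)
      show ?case
      proof (intro allI impI)
        fix n assume "fast \<beta> (Suc k) \<le> n"
        then have "real (2 * (Suc k)\<^sup>2 * fast \<beta> k) \<le> f n"
          using large[OF f_in le_trans[OF elim]] by blast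
        moreover have "real ((Suc k)\<^sup>2 * fast \<beta> k) \<le> real (2 * (Suc k)\<^sup>2 * fast \<beta> k)"
          unfolding of_nat_le_iff by simp
        ultimately show "real ((Suc k)\<^sup>2 * fast \<beta> k) \<le> f n" by linarith
      qed
    qed
    ultimately show ?thesis
      using fast.incomparable_jump[OF X(1)[where x = x] X_inf] assms(1) f_in
      unfolding g_def[abs_def] by blast
  qed
  moreover have "incomparable (Z_ideal (g x)) (Z_ideal (g y))" if "g x \<noteq> g y" for x y
    using g_diff[of x y] g_diff[of y x] that by (auto simp: incomparable_def)
  ultimately show ?thesis by (intro exI[of _ "range g"]) blast
qed

end
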